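(* Let $\mathbf d=(d_0,d_1,\dots,d_L)$ with $d_i\ge 2$ for $i=0,1,\dots,L-1$, and let $\sigma(x)=1/x$. Let $P_{i,\mathbf w}$ ($1\le i\le d_L$) and $Q_{\mathbf w}$ be the numerator polynomials and the common denominator polynomial of the rational neural network with architecture $(\mathbf d,\sigma)$, as defined in the context. Then $$\deg(P_{i,\mathbf w})=\prod_{j=1}^{L-1}(d_j-1)+\sum_{k=1}^{\lfloor (L-1)/2\rfloor}d_{L-2k}\prod_{j=1}^{L-2k-1}(d_j-1),$$ $$\deg(Q_{\mathbf w})=\sum_{k=1}^{\lfloor L/2\rfloor}d_{L-2k+1}\prod_{j=1}^{L-2k}(d_j-1).$$
   Context: For weights $w_{k,i,j}$ ($1\le k\le L$, $1\le i\le d_k$, $1\le j\le d_{k-1}$), regarded as independent variables, and $\mathbf x=(x_1,\dots,x_{d_0})$, define $p^{(1)}_{i}(\mathbf x):=\sum_{j=1}^{d_0}w_{1,i,j}x_j$, $q^{(0)}:=q^{(1)}:=1$, and for $k\ge1$ $$p^{(k+1)}_{i}:=\sum_{j=1}^{d_k}w_{k+1,i,j}\prod_{s\neq j}p^{(k)}_{s},\qquad q^{(k+1)}:=\prod_{j=1}^{d_k}p^{(k)}_{j}.$$ Then $P_{i,\mathbf w}:=p^{(L)}_i\,q^{(L-1)}q^{(L-3)}\cdots q^{(\delta(L+1))}$ and $Q_{\mathbf w}:=q^{(L)}q^{(L-2)}\cdots q^{(\delta(L))}$, where $\delta(n)\in\{0,1\}$ is the parity of $n$ ($0$ if even, $1$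 if odd). Degrees are with respect to $\mathbf x$; empty products equal $1$ and empty sums equal $0$. *)

theory Defs
  imports "HOL-Library.Poly_Mapping"
begin

text \<open>
  The weights are independent variables and degrees are taken in the input variables only, so
  everything lives in the iterated polynomial ring \<open>K[w][x]\<close>: the coefficients are polynomials
  over \<open>K\<close> in the variables \<open>w\<^sub>k\<^sub>,\<^sub>i\<^sub>,\<^sub>j\<close>. Monomials are finitely supported exponent maps. There
  are infinitely many variables of each kind, but a network with widths \<open>d\<close> uses only
  \<open>x\<^sub>1, \<dots>, x\<^sub>d\<^sub>0\<close> and the \<open>w\<^sub>k\<^sub>,\<^sub>i\<^sub>,\<^sub>j\<close> in the index ranges of its layers.
\<close>

type_synonym 'a weight_poly = "(nat \<times> nat \<times> nat \<Rightarrow>\<^sub>0 nat) \<Rightarrow>\<^sub>0 'a"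
type_synonym 'a net_poly = "(nat \<Rightarrow>\<^sub>0 nat) \<Rightarrow>\<^sub>0 'a weight_poly"

definition weight_var :: "nat \<Rightarrow> nat \<Rightarrow> nat \<Rightarrow> 'a::comm_ring_1 net_poly" where
  "weight_var k i j = Poly_Mapping.single 0 (Poly_Mapping.single (Poly_Mapping.single (k, i, j) 1) 1)"

definition input_var :: "nat \<Rightarrow> 'a::comm_ring_1 net_poly" where
  "input_var j = Poly_Mapping.single (Poly_Mapping.single j 1) 1"

text \<open>Total degree in \<open>x\<close>; the zero polynomial gets degree 0, as for univariate polynomials in
  the library.\<close>

definition deg_x :: "'a::comm_ring_1 net_poly \<Rightarrow> nat" where
  "deg_x f = Max (insert 0
     ((\<lambda>m. \<Sum>v\<in>Poly_Mapping.keys m. Poly_Mapping.lookup m v) ` Poly_Mapping.keys f))"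

text \<open>\<open>net_p d k i\<close> is meaningful for \<open>k \<ge> 1\<close> only; its value at \<open>k = 0\<close> is never used.\<close>

fun net_p :: "(nat \<Rightarrow> nat) \<Rightarrow> nat \<Rightarrow> nat \<Rightarrow> 'a::comm_ring_1 net_poly" where
  "net_p d 0 i = 0"
| "net_p d (Suc 0) i = (\<Sum>j=1..d 0. weight_var 1 i j * input_var j)"
| "net_p d (Suc (Suc k)) i =
     (\<Sum>j=1..d (Suc k). weight_var (Suc (Suc k)) i j *
        (\<Prod>s\<in>{1..d (Suc k)} - {j}. net_p d (Suc k) s))"

fun net_q :: "(nat \<Rightarrow> nat) \<Rightarrow> nat \<Rightarrow> 'a::comm_ring_1 net_poly" where
  "net_q d 0 = 1"
| "net_q d (Suc 0) = 1"
| "net_q d (Suc (Suc k)) = (\<Prod>j=1..d (Suc k). net_p d (Suc k) j)"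

text \<open>The indices of the \<open>q\<close>-factors descend in steps of 2 and end in 0 or 1 according to
  parity. The depth \<open>L\<close> is at least 1.\<close>

definition net_P :: "(nat \<Rightarrow> nat) \<Rightarrow> nat \<Rightarrow> nat \<Rightarrow> 'a::comm_ring_1 net_poly" where
  "net_P d L i = net_p d L i * (\<Prod>k=0..(L - 1) div 2. net_q d (L - 1 - 2 * k))"

definition net_Q :: "(nat \<Rightarrow> nat) \<Rightarrow> nat \<Rightarrow> 'a::comm_ring_1 net_poly" where
  "net_Q d L = (\<Prod>k=0..L div 2. net_q d (L - 2 * k))"

end

theory Submission
  imports Defs
begin

text \<open>
  Both formulas come from homogeneity. Layer by layer, every \<open>p\<^sup>(\<^sup>k\<^sup>)\<^sub>i\<close> is homogeneous in \<open>x\<close>: passing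
  to the next layer multiplies together all but one of the \<open>d\<^sub>k\<close> polynomials of the current one, so
  the degree is multiplied by \<open>d\<^sub>k - 1\<close>, and \<open>q\<^sup>(\<^sup>k\<^sup>+\<^sup>1\<^sup>)\<close>, the product of all of them, has \<open>d\<^sub>k\<close> times
  their degree. Degrees of homogeneous factors add up, and the stated sums arise
  (\<open>homogeneous_net_p\<close>, \<open>homogeneous_prod_net_q\<close>).

  A homogeneous polynomial has the expected degree once it is nonzero, so what remains is that
  the sums defining \<open>p\<^sup>(\<^sup>k\<^sup>)\<^sub>i\<close> never cancel. Set every weight \<open>w\<^sub>k\<^sub>,\<^sub>i\<^sub>,\<^sub>j\<close> with \<open>j \<noteq> 1\<close> to zero. Then
  \<open>p\<^sup>(\<^sup>1\<^sup>)\<^sub>i\<close> becomes \<open>w\<^sub>1\<^sub>,\<^sub>i\<^sub>,\<^sub>1 x\<^sub>1\<close>, and inductively each \<open>p\<^sup>(\<^sup>k\<^sup>)\<^sub>i\<close> becomes one monomial with coefficient 1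
  in \<open>w\<close> and \<open>x\<close>, since only the first summand of its definition survives and monomials are closed
  under products (\<open>net_p_mod_side_weights\<close>). Hence \<open>P\<close> and \<open>Q\<close>, being products of
  such polynomials, also specialise to monomials and do not vanish. The specialisation is carried
  out as a congruence modulo the ideal generated by the weights that are set to zero.
\<close>

section \<open>Homogeneity in the input variables\<close>

definition mon_deg :: "('v \<Rightarrow>\<^sub>0 nat) \<Rightarrow> nat" where
  "mon_deg m = (\<Sum>v\<in>Poly_Mapping.keys m. Poly_Mapping.lookup m v)"

definition homogeneous :: "nat \<Rightarrow> (('v \<Rightarrow>\<^sub>0 nat) \<Rightarrow>\<^sub>0 'b::zero) \<Rightarrow> bool" where
  "homogeneous n f \<longleftrightarrow> (\<forall>m\<in>Poly_Mapping.keys f. mon_deg m = n)"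

lemma mon_deg_0 [simp]: "mon_deg 0 = 0"
  by (simp add: mon_deg_def)

lemma mon_deg_single [simp]: "mon_deg (Poly_Mapping.single v n) = n"
  by (simp add: mon_deg_def)

lemma mon_deg_add: "mon_deg (a + b) = mon_deg a + mon_deg b"
  unfolding mon_deg_def by (rule setsum_keys_plus_distrib) auto

lemma homogeneous_0: "homogeneous n 0"
  by (simp add: homogeneous_def)

lemma homogeneous_single: "homogeneous (mon_deg m) (Poly_Mapping.single m c)"
  by (simp add: homogeneous_def)

lemma homogeneous_1: "homogeneous 0 (1 :: ('v \<Rightarrow>\<^sub>0 nat) \<Rightarrow>\<^sub>0 'b::comm_ring_1)"
  by (simp add: homogeneous_def)

lemma homogeneous_add: "homogeneous n f \<Longrightarrow> homogeneous n g \<Longrightarrow> homogeneous n (f + g)"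
  using keys_add[of f g] by (auto simp: homogeneous_def)

lemma homogeneous_mult:
  fixes f g :: "('v \<Rightarrow>\<^sub>0 nat) \<Rightarrow>\<^sub>0 'b::comm_ring_1"
  shows "homogeneous m f \<Longrightarrow> homogeneous n g \<Longrightarrow> homogeneous (m + n) (f * g)"
  using keys_mult[of f g] by (fastforce simp: homogeneous_def mon_deg_add)

lemma homogeneous_sum:
  "(\<And>i. i \<in> A \<Longrightarrow> homogeneous n (f i)) \<Longrightarrow> homogeneous n (\<Sum>i\<in>A. f i)"
  by (induction A rule: infinite_finite_induct) (simp_all add: homogeneous_0 homogeneous_add)

lemma homogeneous_prod:
  fixes f :: "'i \<Rightarrow> ('v \<Rightarrow>\<^sub>0 nat) \<Rightarrow>\<^sub>0 'b::comm_ring_1"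
  shows "(\<And>i. i \<in> A \<Longrightarrow> homogeneous (n i) (f i)) \<Longrightarrow> homogeneous (\<Sum>i\<in>A. n i) (\<Prod>i\<in>A. f i)"
  by (induction A rule: infinite_finite_induct) (simp_all add: homogeneous_1 homogeneous_mult)

lemma deg_x_homogeneous:
  assumes "homogeneous n f" and "f \<noteq> 0"
  shows "deg_x f = n"
proof -
  have "Poly_Mapping.keys f \<noteq> {}"
    using assms(2) by simp
  hence "mon_deg ` Poly_Mapping.keys f = {n}"
    using assms(1) by (auto simp: homogeneous_def image_constant_conv)
  thus ?thesis
    by (simp add: deg_x_def flip: mon_deg_def)
qed

lemma homogeneous_weight_var: "homogeneous 0 (weight_var k i j)"
  using homogeneous_single[of 0] by (simp add: weight_var_def)

lemma homogeneous_input_var: "homogeneous 1 (input_var j)"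
  using homogeneous_single[of "Poly_Mapping.single j 1"] by (simp add: input_var_def)

lemma homogeneous_net_p: "homogeneous (\<Prod>j=1..k. d j - 1) (net_p d (Suc k) i :: 'a::comm_ring_1 net_poly)"
proof (induction k arbitrary: i)
  case 0
  show ?case
    using homogeneous_mult[OF homogeneous_weight_var homogeneous_input_var]
    by (auto intro!: homogeneous_sum)
next
  case (Suc k)
  have "homogeneous (\<Prod>j=1..Suc k. d j - 1)
      (weight_var (Suc (Suc k)) i j * (\<Prod>s\<in>{1..d (Suc k)} - {j}. net_p d (Suc k) s) :: 'a net_poly)"
    if "j \<in> {1..d (Suc k)}" for j
  proof -
    have "homogeneous (\<Sum>s\<in>{1..d (Suc k)} - {j}. \<Prod>j=1..k. d j - 1)
        (\<Prod>s\<in>{1..d (Suc k)} - {j}. net_p d (Suc k) s :: 'a net_poly)"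
      by (intro homogeneous_prod Suc.IH)
    from homogeneous_mult[OF homogeneous_weight_var this] show ?thesis
      using that by (simp add: mult.commute)
  qed
  thus ?case
    unfolding net_p.simps by (rule homogeneous_sum)
qed

lemma homogeneous_net_q:
  "homogeneous (d (Suc k) * (\<Prod>j=1..k. d j - 1)) (net_q d (Suc (Suc k)))"
proof -
  have "homogeneous (\<Sum>s=1..d (Suc k). \<Prod>j=1..k. d j - 1) (net_q d (Suc (Suc k)))"
    unfolding net_q.simps by (intro homogeneous_prod homogeneous_net_p)
  thus ?thesis
    by simp
qed

text \<open>
  The last factor, of index 0 or 1, is constant. This is why the degree sum has one term
  fewer than the product has factors.
\<close>

lemma homogeneous_prod_net_q:
  "homogeneous (\<Sum>k=1..M div 2. d (M - 2 * k + 1) * (\<Prod>j=1..M - 2 * k. d j - 1))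
     (\<Prod>k=0..M div 2. net_q d (M - 2 * k) :: 'a::comm_ring_1 net_poly)"
proof (induction M rule: less_induct)
  case (less M)
  consider "M = 0" | "M = 1" | N where "M = Suc (Suc N)"
    by (metis One_nat_def not0_implies_Suc)
  thus ?case
  proof cases
    case 3
    let ?D = "\<lambda>M k. d (M - 2 * k + 1) * (\<Prod>j=1..M - 2 * k. d j - 1)"
    have "(\<Prod>k=0..M div 2. net_q d (M - 2 * k)) =
        net_q d M * (\<Prod>k=0..N div 2. net_q d (N - 2 * k) :: 'a net_poly)"
      using 3 by (simp add: prod.atLeast0_atMost_Suc_shift del: prod.cl_ivl_Suc net_q.simps)
    moreover have "(\<Sum>k=1..M div 2. ?D M k) = d (Suc N) * (\<Prod>j=1..N. d j - 1) + (\<Sum>k=1..N div 2. ?D N k)"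
    proof -
      have "(\<Sum>k=1..M div 2. ?D M k) = ?D M 1 + (\<Sum>k=Suc 1..Suc (N div 2). ?D M k)"
        using 3 by (simp add: sum.atLeast_Suc_atMost)
      also have "(\<Sum>k=Suc 1..Suc (N div 2). ?D M k) = (\<Sum>k=1..N div 2. ?D N k)"
        using 3 by (simp only: sum.shift_bounds_cl_Suc_ivl) simp
      finally show ?thesis
        using 3 by simp
    qed
    moreover have "homogeneous (\<Sum>k=1..N div 2. ?D N k) (\<Prod>k=0..N div 2. net_q d (N - 2 * k) :: 'a net_poly)"
      by (rule less.IH) (simp add: 3)
    ultimately show ?thesis
      by (simp only: 3 homogeneous_mult homogeneous_net_q)
  qed (simp_all add: homogeneous_1)
qed


section \<open>Setting all weights but the first of each unit to zero\<close>

definition main_weights :: "(nat \<times> nat \<times> nat) set" where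
  "main_weights = {(k, i, j). j = 1}"

text \<open>
  Polynomials in which every monomial contains some other weight, that is, the ideal of
  \<open>K[w]\<close> generated by the weights set to zero; \<open>side_ideal\<close> is the ideal of \<open>K[w][x]\<close> that
  they generate.
\<close>

definition side_weight_ideal :: "'a::comm_ring_1 weight_poly set" where
  "side_weight_ideal = {c. \<forall>u\<in>Poly_Mapping.keys c. \<not> Poly_Mapping.keys u \<subseteq> main_weights}"

definition side_ideal :: "'a::comm_ring_1 net_poly set" where
  "side_ideal = {f. \<forall>m. Poly_Mapping.lookup f m \<in> side_weight_ideal}"

lemma side_weight_ideal_0: "0 \<in> side_weight_ideal"
  by (simp add: side_weight_ideal_def)

lemma side_weight_ideal_add:
  "a \<in> side_weight_ideal \<Longrightarrow> b \<in> side_weight_ideal \<Longrightarrow> a + b \<in> side_weight_ideal"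
  using keys_add[of a b] by (auto simp: side_weight_ideal_def)

lemma side_weight_ideal_sum:
  "(\<And>i. i \<in> A \<Longrightarrow> f i \<in> side_weight_ideal) \<Longrightarrow> (\<Sum>i\<in>A. f i) \<in> side_weight_ideal"
  by (induction A rule: infinite_finite_induct)
    (simp_all add: side_weight_ideal_0 side_weight_ideal_add)

text \<open>
  Exponents are natural numbers, so a variable that occurs in a factor of a monomial occurs
  in the monomial.
\<close>

lemma side_weight_ideal_mult:
  assumes "a \<in> side_weight_ideal"
  shows "a * b \<in> side_weight_ideal"
proof -
  have "Poly_Mapping.keys u \<subseteq> Poly_Mapping.keys (u + v)" for u v :: "nat \<times> nat \<times> nat \<Rightarrow>\<^sub>0 nat"
    by (auto simp: in_keys_iff lookup_add)
  thus ?thesis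
    using assms keys_mult[of a b] unfolding side_weight_ideal_def by blast
qed

lemma side_ideal_0: "0 \<in> side_ideal"
  by (simp add: side_ideal_def side_weight_ideal_0)

lemma side_ideal_add: "f \<in> side_ideal \<Longrightarrow> g \<in> side_ideal \<Longrightarrow> f + g \<in> side_ideal"
  by (simp add: side_ideal_def lookup_add side_weight_ideal_add)

lemma side_ideal_sum: "(\<And>i. i \<in> A \<Longrightarrow> f i \<in> side_ideal) \<Longrightarrow> (\<Sum>i\<in>A. f i) \<in> side_ideal"
  by (simp add: side_ideal_def lookup_sum side_weight_ideal_sum)

lemma side_ideal_mult:
  assumes "f \<in> side_ideal"
  shows "f * g \<in> side_ideal"
  using assms unfolding side_ideal_def
  by (auto simp: lookup_mult Sum_any.expand_set intro!: side_weight_ideal_sum side_weight_ideal_mult)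

lemma weight_var_in_side_ideal: "j \<noteq> 1 \<Longrightarrow> weight_var k i j \<in> side_ideal"
  by (auto simp: side_ideal_def weight_var_def lookup_single when_def side_weight_ideal_0)
    (auto simp: side_weight_ideal_def main_weights_def)


section \<open>Nonvanishing\<close>

definition main_monomials :: "'a::comm_ring_1 net_poly set" where
  "main_monomials =
     {Poly_Mapping.single m (Poly_Mapping.single u 1) | m u. Poly_Mapping.keys u \<subseteq> main_weights}"

definition monomial_mod_side :: "'a::comm_ring_1 net_poly \<Rightarrow> bool" where
  "monomial_mod_side f \<longleftrightarrow> (\<exists>g\<in>main_monomials. f - g \<in> side_ideal)"

lemma main_monomials_1: "1 \<in> main_monomials"
  unfolding main_monomials_def by (auto intro!: exI[of _ 0])

lemma main_monomials_mult:
  assumes "f \<in> main_monomials" and "g \<in> main_monomials"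
  shows "f * g \<in> main_monomials"
proof -
  obtain m u n v where f: "f = Poly_Mapping.single m (Poly_Mapping.single u 1)"
    and g: "g = Poly_Mapping.single n (Poly_Mapping.single v 1)"
    and uv: "Poly_Mapping.keys u \<subseteq> main_weights" "Poly_Mapping.keys v \<subseteq> main_weights"
    using assms unfolding main_monomials_def by blast
  have "f * g = Poly_Mapping.single (m + n) (Poly_Mapping.single (u + v) 1)"
    by (simp add: f g mult_single)
  moreover have "Poly_Mapping.keys (u + v) \<subseteq> main_weights"
    using uv keys_add[of u v] by blast
  ultimately show ?thesis
    unfolding main_monomials_def by blast
qed

lemma weight_var_main: "weight_var k i 1 \<in> main_monomials"
  unfolding main_monomials_def weight_var_def main_weights_def by fastforce

lemma input_var_main: "input_var j \<in> main_monomials"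
  unfolding main_monomials_def input_var_def by (auto intro!: exI[of _ 0] exI[of _ "Poly_Mapping.single j 1"])

lemma monomial_mod_side_main: "f \<in> main_monomials \<Longrightarrow> monomial_mod_side f"
  unfolding monomial_mod_side_def by (metis diff_self side_ideal_0)

lemma monomial_mod_side_mult:
  assumes "monomial_mod_side f" and "monomial_mod_side g"
  shows "monomial_mod_side (f * g)"
proof -
  obtain f' g' where "f' \<in> main_monomials" "g' \<in> main_monomials"
    and *: "f - f' \<in> side_ideal" "g - g' \<in> side_ideal"
    using assms unfolding monomial_mod_side_def by blast
  moreover have "f * g - f' * g' \<in> side_ideal"
  proof -
    have "f * g - f' * g' = (f - f') * g + (g - g') * f'"
      by (simp add: algebra_simps)
    thus ?thesis
      using * by (metis side_ideal_add side_ideal_mult)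
  qed
  ultimately show ?thesis
    unfolding monomial_mod_side_def by (metis main_monomials_mult)
qed

lemma monomial_mod_side_prod:
  "(\<And>i. i \<in> A \<Longrightarrow> monomial_mod_side (f i)) \<Longrightarrow> monomial_mod_side (\<Prod>i\<in>A. f i)"
  by (induction A rule: infinite_finite_induct)
    (simp_all add: monomial_mod_side_main main_monomials_1 monomial_mod_side_mult)

lemma monomial_mod_side_add:
  assumes "monomial_mod_side f" and "r \<in> side_ideal"
  shows "monomial_mod_side (f + r)"
proof -
  obtain g where "g \<in> main_monomials" "f - g \<in> side_ideal"
    using assms(1) unfolding monomial_mod_side_def by blast
  moreover have "f + r - g = (f - g) + r"
    by simp
  ultimately show ?thesis
    using assms(2) unfolding monomial_mod_side_def by (metis side_ideal_add)
qed

text \<open>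
  If \<open>f\<close> were zero, the monomial it is congruent to would lie in the ideal up to sign, although
  it contains no weight outside \<open>main_weights\<close>.
\<close>

lemma monomial_mod_side_nonzero:
  assumes "monomial_mod_side f"
  shows "f \<noteq> 0"
proof
  assume "f = 0"
  then obtain m u where u: "Poly_Mapping.keys u \<subseteq> main_weights"
    and "- Poly_Mapping.single m (Poly_Mapping.single u (1::'a)) \<in> side_ideal"
    using assms unfolding monomial_mod_side_def main_monomials_def by auto
  hence "- Poly_Mapping.single u (1::'a) \<in> side_weight_ideal"
    unfolding side_ideal_def by (auto dest: spec[of _ m])
  thus False
    using u by (simp add: side_weight_ideal_def)
qed

text \<open>
  Only the summand with \<open>j = 1\<close> survives the specialisation, so there is nothing it could
  cancel against.
\<close>

lemma monomial_mod_side_weighted_sum: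
  assumes "n \<ge> 1" and "monomial_mod_side (f 1)"
  shows "monomial_mod_side (\<Sum>j=1..n. weight_var k i j * f j)"
proof -
  have "(\<Sum>j=1..n. weight_var k i j * f j) =
      weight_var k i 1 * f 1 + (\<Sum>j=Suc 1..n. weight_var k i j * f j)"
    using assms(1) by (rule sum.atLeast_Suc_atMost)
  moreover have "(\<Sum>j=Suc 1..n. weight_var k i j * f j) \<in> side_ideal"
    by (intro side_ideal_sum side_ideal_mult weight_var_in_side_ideal) auto
  ultimately show ?thesis
    using assms(2)
    by (simp only: monomial_mod_side_add monomial_mod_side_mult monomial_mod_side_main weight_var_main)
qed

lemma net_p_mod_side_weights:
  assumes "\<And>j. j \<le> k \<Longrightarrow> d j \<ge> 1"
  shows "monomial_mod_side (net_p d (Suc k) i)"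
  using assms
proof (induction k arbitrary: i)
  case 0
  thus ?case
    by (simp only: net_p.simps)
      (intro monomial_mod_side_weighted_sum monomial_mod_side_main input_var_main; simp)
next
  case (Suc k)
  thus ?case
    by (simp only: net_p.simps)
      (intro monomial_mod_side_weighted_sum monomial_mod_side_prod; simp)
qed

lemma net_q_mod_side_weights:
  assumes "\<And>j. j + 1 < k \<Longrightarrow> d j \<ge> 1"
  shows "monomial_mod_side (net_q d k)"
proof -
  consider "k = 0" | "k = 1" | n where "k = Suc (Suc n)"
    by (metis One_nat_def not0_implies_Suc)
  thus ?thesis
  proof cases
    case 3
    thus ?thesis
      using assms by (simp only: net_q.simps) (intro monomial_mod_side_prod net_p_mod_side_weights; simp)
  qed (simp_all add: monomial_mod_side_main main_monomials_1)
qed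


section \<open>The degrees of numerator and denominator\<close>

theorem lemma2p5:
  fixes d :: "nat \<Rightarrow> nat" and L :: nat
  assumes "L \<ge> 1"
    and "\<And>i. i < L \<Longrightarrow> d i \<ge> 2"
  shows "(\<forall>i\<in>{1..d L}. deg_x (net_P d L i :: 'a::field net_poly) =
            (\<Prod>j=1..L - 1. d j - 1)
            + (\<Sum>k=1..(L - 1) div 2. d (L - 2 * k) * (\<Prod>j=1..L - 2 * k - 1. d j - 1)))
       \<and> deg_x (net_Q d L :: 'a net_poly) =
            (\<Sum>k=1..L div 2. d (L - 2 * k + 1) * (\<Prod>j=1..L - 2 * k. d j - 1))"
proof -
  have width: "d j \<ge> 1" if "j < L" for j
    using assms(2)[OF that] by simp
  obtain n where L: "L = Suc n"
    using assms(1) by (cases L) auto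
  have q_prod: "monomial_mod_side (\<Prod>k=0..M div 2. net_q d (M - 2 * k) :: 'a net_poly)"
    if "M \<le> L" for M
    using width that by (intro monomial_mod_side_prod net_q_mod_side_weights) auto
  have "deg_x (net_P d L i :: 'a net_poly) = (\<Prod>j=1..L - 1. d j - 1)
      + (\<Sum>k=1..(L - 1) div 2. d (L - 2 * k) * (\<Prod>j=1..L - 2 * k - 1. d j - 1))" for i
  proof -
    have "monomial_mod_side (net_p d L i :: 'a net_poly)"
      using width unfolding L by (intro net_p_mod_side_weights) simp
    hence "(net_P d L i :: 'a net_poly) \<noteq> 0"
      unfolding net_P_def by (intro monomial_mod_side_nonzero monomial_mod_side_mult q_prod) simp_all
    moreover have "homogeneous ((\<Prod>j=1..n. d j - 1)
        + (\<Sum>k=1..n div 2. d (n - 2 * k + 1) * (\<Prod>j=1..n - 2 * k. d j - 1)))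
        (net_P d L i :: 'a net_poly)"
      unfolding net_P_def L diff_Suc_1
      by (intro homogeneous_mult homogeneous_net_p homogeneous_prod_net_q)
    moreover have "(\<Sum>k=1..n div 2. d (n - 2 * k + 1) * (\<Prod>j=1..n - 2 * k. d j - 1))
        = (\<Sum>k=1..n div 2. d (L - 2 * k) * (\<Prod>j=1..L - 2 * k - 1. d j - 1))"
    proof (rule sum.cong)
      \<comment> \<open>The bound on \<open>k\<close> keeps the subtractions of natural numbers from truncating.\<close>
      fix k assume "k \<in> {1..n div 2}"
      hence "n - 2 * k + 1 = L - 2 * k"
        unfolding L by auto
      moreover from this have "n - 2 * k = L - 2 * k - 1"
        by simp
      ultimately show "d (n - 2 * k + 1) * (\<Prod>j=1..n - 2 * k. d j - 1)
          = d (L - 2 * k) * (\<Prod>j=1..L - 2 * k - 1. d j - 1)"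
        by simp
    qed simp
    ultimately show ?thesis
      by (simp add: L deg_x_homogeneous)
  qed
  moreover have "deg_x (net_Q d L :: 'a net_poly) =
      (\<Sum>k=1..L div 2. d (L - 2 * k + 1) * (\<Prod>j=1..L - 2 * k. d j - 1))"
    unfolding net_Q_def
    by (intro deg_x_homogeneous homogeneous_prod_net_q monomial_mod_side_nonzero q_prod order_refl)
  ultimately show ?thesis
    by blast
qed

end
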